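(* Let $m\in\mathbb{N}$ and consider the $m$th last-success problem in an infinite sequence $X_1,X_2,\dots$ of independent Bernoulli trials with success probabilities $p_k=\mathbb{P}(X_k=1)\in[0,1)$. Suppose $\sum_k p_k<\infty$ and that zero payoff is awarded for never stopping. Then an optimal rule exists, and the optimal strategy is to stop at the first success, if any, occurring on or after index $$k^*=\min\{j\in\mathbb{N}: e_m(j)\le e_{m-1}(j)\}.$$ The optimal value of the problem is $s_m(k^* )$.
   Context: In the $m$th last-success problem one chooses a stopping rule $\tau$ (nonanticipating with respect to the filtration generated by the trials, possibly $\tau=\infty$), stopping on a success, so as to maximise the probability that $\sum_{j\ge\tau}X_j=m$, i.e. that the selected success is the $m$th last one. Let $r_k=p_k/(1-p_k)$. For $k\in\mathbb{N}$ let $e_0(k)=1$ and, for $i\ge 1$, $e_i(k)=\sum_{k\le t_1<\cdots<t_i}r_{t_1}\cdots r_{t_i}$ (the $i$th elementary symmetric function of $r_k,r_{k+1},\dots$). Let $s_0(k)=\prod_{j\ge k}(1-p_j)$ and $s_i(k)=s_0(k)e_i(k)$, which is the probability of exactly $i$ successes among trials $k,k+1,\dots$.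
   Formalization: The index is corrected to k* = min{j : e_m(j+1) ≤ e_{m-1}(j+1)}; with the printed comparison at j the claim fails, e.g. m = 1, p_1 = 2/3, all other p_k = 0 gives k* = 2 and value 0, while stopping at a success in trial 1 wins with probability 2/3. *)

theory Defs
  imports "HOL-Probability.Probability"
begin

text \<open>Trials are indexed by the positive integers; the values at index \<open>0\<close> of the sequences
  \<open>p\<close> and \<open>X\<close> are never used.\<close>

definition odds :: "(nat \<Rightarrow> real) \<Rightarrow> nat \<Rightarrow> real" where
  "odds p k = p k / (1 - p k)"

text \<open>Increasing tuples \<open>k \<le> t\<^sub>1 < \<dots> < t\<^sub>i\<close> are represented by their sets of entries. The guard
  \<open>finite T\<close> matters only for \<open>i = 0\<close>, as infinite sets have \<open>card\<close> zero.\<close>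

definition elem_sym :: "(nat \<Rightarrow> real) \<Rightarrow> nat \<Rightarrow> nat \<Rightarrow> real" where
  "elem_sym p i k = (\<Sum>\<^sub>\<infinity>T\<in>{T. T \<subseteq> {k..} \<and> finite T \<and> card T = i}. \<Prod>t\<in>T. odds p t)"

definition succ_prob :: "(nat \<Rightarrow> real) \<Rightarrow> nat \<Rightarrow> nat \<Rightarrow> real" where
  "succ_prob p i k = (\<Prod>j. 1 - p (k + j)) * elem_sym p i k"

definition trial_filtration ::
  "'a measure \<Rightarrow> (nat \<Rightarrow> 'a \<Rightarrow> bool) \<Rightarrow> enat \<Rightarrow> 'a measure" where
  "trial_filtration M X t =
     sigma (space M) {X j -` A \<inter> space M | j A. 1 \<le> j \<and> enat j \<le> t}"

text \<open>The value \<open>\<infinity>\<close> means never stopping. The second condition also excludes stopping at time \<open>0\<close>.\<close>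

definition stopping_rule ::
  "'a measure \<Rightarrow> (nat \<Rightarrow> 'a \<Rightarrow> bool) \<Rightarrow> ('a \<Rightarrow> enat) \<Rightarrow> bool" where
  "stopping_rule M X \<tau> \<longleftrightarrow>
     stopping_time (trial_filtration M X) \<tau> \<and>
     (\<forall>\<omega>\<in>space M. \<forall>n. \<tau> \<omega> = enat n \<longrightarrow> 1 \<le> n \<and> X n \<omega>)"

text \<open>Outcomes with \<open>\<tau> \<omega> = \<infinity>\<close> do not count as a win: never stopping pays zero. Convergence is
  in the discrete space \<open>nat\<close>, so infinitely many successes do not count either.\<close>

definition win_prob ::
  "'a measure \<Rightarrow> (nat \<Rightarrow> 'a \<Rightarrow> bool) \<Rightarrow> nat \<Rightarrow> ('a \<Rightarrow> enat) \<Rightarrow> real" where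
  "win_prob M X m \<tau> =
     measure M {\<omega>\<in>space M. \<exists>n. \<tau> \<omega> = enat n \<and> (\<lambda>j. of_bool (X (n + j) \<omega>) :: nat) sums m}"

definition optimal_rule ::
  "'a measure \<Rightarrow> (nat \<Rightarrow> 'a \<Rightarrow> bool) \<Rightarrow> nat \<Rightarrow> ('a \<Rightarrow> enat) \<Rightarrow> bool" where
  "optimal_rule M X m \<tau> \<longleftrightarrow>
     stopping_rule M X \<tau> \<and> (\<forall>\<sigma>. stopping_rule M X \<sigma> \<longrightarrow> win_prob M X m \<sigma> \<le> win_prob M X m \<tau>)"

definition optimal_value :: "'a measure \<Rightarrow> (nat \<Rightarrow> 'a \<Rightarrow> bool) \<Rightarrow> nat \<Rightarrow> real" where
  "optimal_value M X m = (SUP \<tau>\<in>{\<tau>. stopping_rule M X \<tau>}. win_prob M X m \<tau>)"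

text \<open>The infimum over the empty set is \<open>\<infinity>\<close>: without a success from \<open>k\<close> on, never stop.\<close>

definition first_success_from :: "(nat \<Rightarrow> 'a \<Rightarrow> bool) \<Rightarrow> nat \<Rightarrow> 'a \<Rightarrow> enat" where
  "first_success_from X k \<omega> = (INF n\<in>{n. k \<le> n \<and> X n \<omega>}. enat n)"

text \<open>The comparison is made at \<open>j + 1\<close>: stopping at a success in trial \<open>j\<close> wins with probability
  \<open>succ_prob p (m - 1) (j + 1)\<close>, to be weighed against \<open>succ_prob p m (j + 1)\<close>, the probability of
  winning by stopping at the next success. Comparing at \<open>j\<close> itself gives a threshold that is not
  optimal: for \<open>m = 1\<close>, \<open>p 1 = 2/3\<close> and all other \<open>p k = 0\<close> it would be \<open>2\<close>, and one would
  never stop.\<close>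

definition threshold_set :: "(nat \<Rightarrow> real) \<Rightarrow> nat \<Rightarrow> nat set" where
  "threshold_set p m = {j. 1 \<le> j \<and> elem_sym p m (j + 1) \<le> elem_sym p (m - 1) (j + 1)}"

definition threshold :: "(nat \<Rightarrow> real) \<Rightarrow> nat \<Rightarrow> nat" where
  "threshold p m = (LEAST j. j \<in> threshold_set p m)"

end

theory Submission
  imports Defs
begin

text \<open>Let \<open>s i k\<close> be the probability of exactly \<open>i\<close> successes from trial \<open>k\<close> on. Conditioning on
  trial \<open>k\<close> gives \<open>s i k = (1 - p k) * s i (k + 1) + p k * s (i - 1) (k + 1)\<close>, which propagates
  log-concavity in \<open>i\<close> backwards from infinity. Log-concavity makes the condition
  \<open>s m (j + 1) \<le> s (m - 1) (j + 1)\<close> persist once it holds, so stopping at successes is favourable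
  exactly from the threshold \<open>t\<close> on, and \<open>k \<mapsto> s m (max k t)\<close> satisfies the dynamic programming
  inequalities. By independence of past and future it therefore bounds the winning probability of
  every stopping rule, and waiting for the first success from \<open>t\<close> on attains the bound.\<close>

subsection \<open>Sets of successes\<close>

definition successes :: "(nat \<Rightarrow> 'a \<Rightarrow> bool) \<Rightarrow> nat \<Rightarrow> 'a \<Rightarrow> nat set" where
  "successes X k \<omega> = {j. k \<le> j \<and> X j \<omega>}"

text \<open>In the discrete space \<open>nat\<close> a convergent sequence of partial sums is
  eventually constant, so no index beyond some \<open>N\<close> satisfies \<open>P\<close>.\<close>

lemma sums_of_bool_nat_iff:
  "(\<lambda>j. of_bool (P j) :: nat) sums i \<longleftrightarrow> finite {j. P j} \<and> card {j. P j} = i"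
proof
  let ?S = "{j. P j}"
  have partial: "(\<Sum>j<n. of_bool (P j) :: nat) = card (?S \<inter> {..<n})" for n
    by (simp add: of_bool_def sum.If_cases Int_commute)
  assume "(\<lambda>j. of_bool (P j) :: nat) sums i"
  then obtain N where N: "card (?S \<inter> {..<n}) = i" if "n \<ge> N" for n
    unfolding sums_def partial tendsto_discrete eventually_sequentially by auto
  have eq: "?S \<inter> {..<N} = ?S \<inter> {..<n}" if "n \<ge> N" for n
    using that N by (intro card_subset_eq) auto
  have "?S = ?S \<inter> {..<N}"
  proof
    show "?S \<subseteq> ?S \<inter> {..<N}"
    proof
      fix x assume "x \<in> ?S"
      then have "x \<in> ?S \<inter> {..<max N (Suc x)}" by auto
      then show "x \<in> ?S \<inter> {..<N}" using eq[of "max N (Suc x)"] by simp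
    qed
  qed auto
  then show "finite ?S \<and> card ?S = i"
    using N[of N] by (metis finite_Int finite_lessThan order_refl)
next
  assume "finite {j. P j} \<and> card {j. P j} = i"
  then show "(\<lambda>j. of_bool (P j) :: nat) sums i"
    using sums_finite[of "{j. P j}" "\<lambda>j. of_bool (P j) :: nat"] by simp
qed

lemma sums_successes_iff:
  "(\<lambda>j. of_bool (X (k + j) \<omega>) :: nat) sums i \<longleftrightarrow>
     finite (successes X k \<omega>) \<and> card (successes X k \<omega>) = i"
proof -
  have "successes X k \<omega> = (+) k ` {j. X (k + j) \<omega>}"
    by (auto simp: successes_def image_iff) (metis le_add_diff_inverse)
  then show ?thesis
    by (simp add: sums_of_bool_nat_iff finite_image_iff card_image)
qed

lemma successes_Suc:
  "successes X k \<omega> = (if X k \<omega> then insert k (successes X (Suc k) \<omega>) else successes X (Suc k) \<omega>)"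
  by (auto simp: successes_def Suc_le_eq le_less)

lemma notin_successes_Suc: "k \<notin> successes X (Suc k) \<omega>"
  by (simp add: successes_def)

lemma first_success_from_le: "k \<le> j \<Longrightarrow> X j \<omega> \<Longrightarrow> first_success_from X k \<omega> \<le> enat j"
  unfolding first_success_from_def by (intro INF_lower) simp

lemma first_success_from_eq_enat_iff:
  "first_success_from X k \<omega> = enat n \<longleftrightarrow> k \<le> n \<and> X n \<omega> \<and> (\<forall>j. k \<le> j \<and> j < n \<longrightarrow> \<not> X j \<omega>)"
proof (cases "\<exists>j. k \<le> j \<and> X j \<omega>")
  case False
  then have none: "{n. k \<le> n \<and> X n \<omega>} = {}" by auto
  have "first_success_from X k \<omega> = \<infinity>"
    unfolding first_success_from_def none by (simp add: top_enat_def)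
  then show ?thesis using False by auto
next
  case True
  define l where "l = (LEAST j. k \<le> j \<and> X j \<omega>)"
  have l: "k \<le> l" "X l \<omega>" and le: "\<And>j. k \<le> j \<Longrightarrow> X j \<omega> \<Longrightarrow> l \<le> j"
    using LeastI_ex[OF True] Least_le[of "\<lambda>j. k \<le> j \<and> X j \<omega>"] unfolding l_def by auto
  have "first_success_from X k \<omega> = enat l"
  proof (rule antisym)
    show "first_success_from X k \<omega> \<le> enat l"
      using l by (rule first_success_from_le)
    show "enat l \<le> first_success_from X k \<omega>"
      unfolding first_success_from_def by (rule INF_greatest) (simp add: le)
  qed
  moreover have "l = n \<longleftrightarrow> k \<le> n \<and> X n \<omega> \<and> (\<forall>j. k \<le> j \<and> j < n \<longrightarrow> \<not> X j \<omega>)"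
    using l le by (meson leD le_neq_implies_less)
  ultimately show ?thesis by simp
qed

subsection \<open>Independence of past and future\<close>

locale bernoulli_trials = prob_space M
  for M :: "'a measure" and X :: "nat \<Rightarrow> 'a \<Rightarrow> bool" and p :: "nat \<Rightarrow> real" +
  assumes indep: "indep_vars (\<lambda>_. count_space UNIV) X {1..}"
    and prob_success: "1 \<le> k \<Longrightarrow> prob {\<omega> \<in> space M. X k \<omega>} = p k"
    and p_range: "1 \<le> k \<Longrightarrow> 0 \<le> p k \<and> p k < 1"
    and p_summable: "summable (\<lambda>k. p (Suc k))"
begin

definition tail_sigma :: "nat \<Rightarrow> 'a measure" where
  "tail_sigma N = sigma (space M) {X j -` A \<inter> space M | j A. N \<le> j}"

lemma space_trial_filtration [simp]: "space (trial_filtration M X t) = space M"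
  by (simp add: trial_filtration_def space_measure_of_conv)

lemma space_tail_sigma [simp]: "space (tail_sigma N) = space M"
  by (simp add: tail_sigma_def space_measure_of_conv)

lemma pred_X_filtration: "1 \<le> j \<Longrightarrow> j \<le> N \<Longrightarrow> Measurable.pred (trial_filtration M X (enat N)) (X j)"
  by (rule measurableI)
     (auto simp: trial_filtration_def sets_measure_of_conv space_measure_of_conv
        intro!: sigma_sets.Basic)

lemma pred_X_tail: "N \<le> j \<Longrightarrow> Measurable.pred (tail_sigma N) (X j)"
  by (rule measurableI)
     (auto simp: tail_sigma_def sets_measure_of_conv space_measure_of_conv
        intro!: sigma_sets.Basic)

lemma pred_X: "1 \<le> j \<Longrightarrow> Measurable.pred M (X j)"
  using indep unfolding indep_vars_def by auto

lemma sets_filtration: "sets (trial_filtration M X t) \<subseteq> events"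
proof -
  have "{X j -` A \<inter> space M | j A. 1 \<le> j \<and> enat j \<le> t} \<subseteq> events" (is "?E \<subseteq> _")
    using measurable_sets[OF pred_X] by auto
  then have "sigma_sets (space M) ?E \<subseteq> events"
    by (rule sets.sigma_sets_subset)
  moreover have "sets (trial_filtration M X t) = sigma_sets (space M) ?E"
    unfolding trial_filtration_def by (rule sets_measure_of) auto
  ultimately show ?thesis
    by (rule ord_eq_le_trans[rotated])
qed

text \<open>\<open>N = 0\<close> is excluded because nothing makes \<open>X 0\<close>
  measurable.\<close>

lemma sets_tail:
  assumes "1 \<le> N"
  shows "sets (tail_sigma N) \<subseteq> events"
proof -
  have "{X j -` A \<inter> space M | j A. N \<le> j} \<subseteq> events" (is "?E \<subseteq> _")
    using measurable_sets[OF pred_X] assms by auto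
  then have "sigma_sets (space M) ?E \<subseteq> events"
    by (rule sets.sigma_sets_subset)
  moreover have "sets (tail_sigma N) = sigma_sets (space M) ?E"
    unfolding tail_sigma_def by (rule sets_measure_of) auto
  ultimately show ?thesis
    by (rule ord_eq_le_trans[rotated])
qed

text \<open>The trials up to \<open>N\<close> and those after it form disjoint blocks, and the
  generators coming from each trial are stable under intersection, so independence passes to the
  generated sigma-algebras. For \<open>N = 0\<close> the past is trivial.\<close>

lemma prob_past_future:
  assumes "A \<in> sets (trial_filtration M X (enat N))" "B \<in> sets (tail_sigma (Suc N))"
  shows "prob (A \<inter> B) = prob A * prob B"
proof -
  define E where "E = (\<lambda>i. {X i -` A \<inter> space M | A. A \<in> sets (count_space (UNIV :: bool set))})"
  \<comment> \<open>The past is block \<open>True\<close> and the future block \<open>False\<close>;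
    a product over \<open>bool\<close> then has exactly two factors.\<close>
  define I where "I = (\<lambda>b. if b then {1..N} else {Suc N..})"
  have Un_I: "(\<Union>b\<in>UNIV. I b) = {1..}"
    by (auto simp: I_def UNIV_bool)
  have "indep_sets E (\<Union>b\<in>UNIV. I b)"
    unfolding Un_I E_def using indep[unfolded indep_vars_def2] by (rule conjunct2)
  moreover have "Int_stable (E i)" for i
  proof (rule Int_stableI)
    fix a b assume "a \<in> E i" "b \<in> E i"
    then obtain A B where "a = X i -` A \<inter> space M" "b = X i -` B \<inter> space M"
      unfolding E_def by blast
    then have "a \<inter> b = X i -` (A \<inter> B) \<inter> space M" by blast
    then show "a \<inter> b \<in> E i"
      unfolding E_def by (intro CollectI exI[of _ "A \<inter> B"]) simp_all
  qed
  moreover have "disjoint_family_on I UNIV"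
    by (auto simp: disjoint_family_on_def I_def)
  ultimately have ind: "indep_sets (\<lambda>b. sigma_sets (space M) (\<Union>i\<in>I b. E i)) UNIV"
    by (intro indep_sets_collect_sigma) auto
  have UN_E: "(\<Union>i\<in>J. E i) = {X j -` A \<inter> space M | j A. j \<in> J}" for J
    unfolding E_def sets_count_space Pow_UNIV by blast
  have "(\<Union>i\<in>I True. E i) = {X j -` A \<inter> space M | j A. 1 \<le> j \<and> enat j \<le> enat N}"
    unfolding UN_E by (simp add: I_def)
  then have A: "A \<in> sigma_sets (space M) (\<Union>i\<in>I True. E i)"
    using assms(1) unfolding trial_filtration_def by (subst (asm) sets_measure_of) auto
  have "(\<Union>i\<in>I False. E i) = {X j -` A \<inter> space M | j A. Suc N \<le> j}"
    unfolding UN_E by (simp add: I_def)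
  then have B: "B \<in> sigma_sets (space M) (\<Union>i\<in>I False. E i)"
    using assms(2) unfolding tail_sigma_def by (subst (asm) sets_measure_of) auto
  have "prob (\<Inter>b\<in>UNIV. (if b then A else B)) = (\<Prod>b\<in>UNIV. prob (if b then A else B))"
    using A B by (intro indep_setsD[OF ind]) auto
  then show ?thesis
    by (simp add: UNIV_bool Int_commute mult.commute)
qed

subsection \<open>Distribution of the number of successes\<close>

text \<open>The finiteness clause keeps outcomes with infinitely many successes out of
  \<open>exactly 0 k\<close>, since infinite sets have \<open>card\<close> zero.\<close>

definition exactly :: "nat \<Rightarrow> nat \<Rightarrow> 'a set" where
  "exactly i k = {\<omega> \<in> space M. finite (successes X k \<omega>) \<and> card (successes X k \<omega>) = i}"

abbreviation s :: "nat \<Rightarrow> nat \<Rightarrow> real" where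
  "s i k \<equiv> prob (exactly i k)"

text \<open>For finite \<open>T\<close> this event has an explicit probability, and there are only
  countably many finite \<open>T\<close>, so \<open>exactly\<close> splits into countably many such
  events.\<close>

definition atom :: "nat set \<Rightarrow> nat \<Rightarrow> 'a set" where
  "atom T k = {\<omega> \<in> space M. successes X k \<omega> = T}"

lemma atom_tail: "atom T k \<in> sets (tail_sigma k)"
proof -
  have "atom T k = {\<omega> \<in> space (tail_sigma k). T \<subseteq> {k..} \<and> (\<forall>j\<in>{k..}. X j \<omega> \<longleftrightarrow> j \<in> T)}"
    by (auto simp: atom_def successes_def)
  also have "\<dots> \<in> sets (tail_sigma k)"
  proof (rule predE)
    have [measurable]: "Measurable.pred (tail_sigma k) (X j)" if "j \<in> {k..}" for j
      using that by (intro pred_X_tail) auto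
    show "Measurable.pred (tail_sigma k) (\<lambda>\<omega>. T \<subseteq> {k..} \<and> (\<forall>j\<in>{k..}. X j \<omega> \<longleftrightarrow> j \<in> T))"
      by measurable
  qed
  finally show ?thesis .
qed

lemma exactly_eq_UN_atom:
  "exactly i k = (\<Union>T\<in>{T. T \<subseteq> {k..} \<and> finite T \<and> card T = i}. atom T k)"
  by (auto simp: exactly_def atom_def successes_def)

lemma countable_finite_subsets: "countable {T :: nat set. T \<subseteq> {k..} \<and> finite T \<and> card T = i}"
  by (rule countable_subset[OF _ countable_Collect_finite]) auto

lemma exactly_tail: "exactly i k \<in> sets (tail_sigma k)"
  unfolding exactly_eq_UN_atom
  by (intro sets.countable_UN'' countable_finite_subsets atom_tail)

lemma exactly_event [measurable]: "1 \<le> k \<Longrightarrow> exactly i k \<in> events"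
  using exactly_tail sets_tail by blast

section \<open>Product formula for the probability of a given success set\<close>

lemma prob_failure:
  assumes "1 \<le> k"
  shows "prob {\<omega> \<in> space M. \<not> X k \<omega>} = 1 - p k"
  using prob_neg[of "X k"] pred_X[OF assms] prob_success[OF assms] by (simp add: pred_def)

abbreviation s0 :: "nat \<Rightarrow> real" where
  "s0 k \<equiv> (\<Prod>j. 1 - p (k + j))"

lemma convergent_prod_failures:
  assumes "1 \<le> k"
  shows "convergent_prod (\<lambda>j. 1 - p (k + j))"
proof -
  have "summable (\<lambda>j. p (Suc (j + (k - 1))))"
    using p_summable by (rule summable_ignore_initial_segment)
  moreover have "(\<lambda>j. p (Suc (j + (k - 1)))) = (\<lambda>j. \<bar>- p (k + j)\<bar>)"
    using assms p_range by (auto intro!: ext simp: add.commute)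
  moreover have "- p (k + j) \<noteq> - 1" for j
    using p_range[of "k + j"] assms by auto
  ultimately show ?thesis
    using summable_imp_convergent_prod_real[of "\<lambda>j. - p (k + j)"] by simp
qed

text \<open>Summability together with \<open>p k < 1\<close> keeps the product away from 0, so it
  can be cancelled when values of \<open>elem_sym\<close> are compared.\<close>

lemma s0_pos: "1 \<le> k \<Longrightarrow> 0 < s0 k"
  using p_range by (intro less_0_prodinf convergent_prod_failures) auto

text \<open>The event is the decreasing limit of the events \<open>C n\<close>, which prescribe only
  \<open>n\<close> trials. Independence makes \<open>prob (C n)\<close> a finite product; writing
  each \<open>p j\<close> as \<open>(1 - p j) * odds p j\<close> separates the failure factors from
  the odds before \<open>n\<close> tends to infinity.\<close>

lemma prob_atom:
  assumes k: "1 \<le> k" and T: "T \<subseteq> {k..}" "finite T"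
  shows "prob (atom T k) = s0 k * (\<Prod>t\<in>T. odds p t)"
proof -
  define C where "C n = {\<omega> \<in> space M. \<forall>j\<in>{k..<k + n}. X j \<omega> \<longleftrightarrow> j \<in> T}" for n
  \<comment> \<open>For \<open>n = 0\<close> the intersection on the right is \<open>UNIV\<close>,
    whereas \<open>C 0\<close> is \<open>space M\<close>.\<close>
  have C_eq: "C n = (\<Inter>j\<in>{k..<k + n}. X j -` {j \<in> T} \<inter> space M)" if "n > 0" for n
    using that unfolding C_def by fastforce
  have prob_C: "prob (C n) = (\<Prod>j\<in>{k..<k + n}. if j \<in> T then p j else 1 - p j)" if "n > 0" for n
  proof -
    have "prob (C n) = (\<Prod>j\<in>{k..<k + n}. prob (X j -` {j \<in> T} \<inter> space M))"
      unfolding C_eq[OF that] using that k by (intro indep_varsD[OF indep]) auto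
    also have "\<dots> = (\<Prod>j\<in>{k..<k + n}. if j \<in> T then p j else 1 - p j)"
    proof (rule prod.cong)
      fix j assume "j \<in> {k..<k + n}"
      then have "1 \<le> j" using k by auto
      moreover have "X j -` {True} \<inter> space M = {\<omega> \<in> space M. X j \<omega>}"
        "X j -` {False} \<inter> space M = {\<omega> \<in> space M. \<not> X j \<omega>}"
        by auto
      ultimately show "prob (X j -` {j \<in> T} \<inter> space M) = (if j \<in> T then p j else 1 - p j)"
        using prob_success prob_failure by (cases "j \<in> T") auto
    qed simp
    finally show ?thesis .
  qed
  obtain N where N: "T \<subseteq> {..<N}"
    using T(2) finite_nat_iff_bounded by auto
  have prob_C': "prob (C n) = (\<Prod>j<n. 1 - p (k + j)) * (\<Prod>t\<in>T. odds p t)"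
    if n: "n > 0" "n \<ge> N" for n
  proof -
    have "prob (C n) = (\<Prod>j\<in>{k..<k + n}. (1 - p j) * (if j \<in> T then odds p j else 1))"
      unfolding prob_C[OF n(1)]
    proof (rule prod.cong)
      fix j assume "j \<in> {k..<k + n}"
      then show "(if j \<in> T then p j else 1 - p j) = (1 - p j) * (if j \<in> T then odds p j else 1)"
        using p_range[of j] k by (auto simp: odds_def)
    qed simp
    also have "\<dots> = (\<Prod>j\<in>{k..<k + n}. 1 - p j) * (\<Prod>j\<in>{k..<k + n} \<inter> T. odds p j)"
      by (simp add: prod.distrib prod.inter_restrict)
    also have "{k..<k + n} \<inter> T = T"
      using T(1) N n by fastforce
    also have "(\<Prod>j\<in>{k..<k + n}. 1 - p j) = (\<Prod>j<n. 1 - p (k + j))"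
      using prod.shift_bounds_nat_ivl[of "\<lambda>j. 1 - p j" 0 k n]
      by (simp add: add.commute lessThan_atLeast0)
    finally show ?thesis .
  qed
  have "C n \<in> events" for n
  proof (cases "n > 0")
    case True
    then show ?thesis
      unfolding C_eq[OF True] using measurable_sets[OF pred_X] k by (intro sets.finite_INT) auto
  next
    case False
    then show ?thesis by (simp add: C_def)
  qed
  moreover have "decseq C"
    by (auto simp: C_def decseq_def)
  ultimately have "(\<lambda>n. prob (C n)) \<longlonglongrightarrow> prob (\<Inter>n. C n)"
    by (intro finite_Lim_measure_decseq) auto
  moreover have "(\<Inter>n. C n) = atom T k"
  proof -
    have "(\<forall>n. \<forall>j\<in>{k..<k + n}. X j \<omega> \<longleftrightarrow> j \<in> T) \<longleftrightarrow> successes X k \<omega> = T" for \<omega>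
    proof
      assume *: "\<forall>n. \<forall>j\<in>{k..<k + n}. X j \<omega> \<longleftrightarrow> j \<in> T"
      have "X j \<omega> \<longleftrightarrow> j \<in> T" if "k \<le> j" for j
        using *[THEN spec, of "Suc (j - k)"] that by auto
      then show "successes X k \<omega> = T"
        using T(1) by (auto simp: successes_def)
    qed (auto simp: successes_def)
    then show ?thesis
      by (auto simp: C_def atom_def)
  qed
  moreover have "(\<lambda>n. prob (C n)) \<longlonglongrightarrow> s0 k * (\<Prod>t\<in>T. odds p t)"
  proof (rule Lim_transform_eventually)
    show "(\<lambda>n. (\<Prod>j<n. 1 - p (k + j)) * (\<Prod>t\<in>T. odds p t)) \<longlonglongrightarrow> s0 k * (\<Prod>t\<in>T. odds p t)"
      using convergent_prod_has_prod[OF convergent_prod_failures[OF k]]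
      by (intro tendsto_intros has_prod_imp_tendsto')
    show "\<forall>\<^sub>F n in sequentially. (\<Prod>j<n. 1 - p (k + j)) * (\<Prod>t\<in>T. odds p t) = prob (C n)"
      using eventually_ge_at_top[of "Suc N"] by eventually_elim (simp add: prob_C')
  qed
  ultimately show ?thesis
    using LIMSEQ_unique by metis
qed

text \<open>Countable additivity over the disjoint atoms writes \<open>s i k\<close> as an integral
  over counting measure; its finiteness yields the summability that identifies it with the infinite
  sum in \<open>elem_sym\<close>.\<close>

lemma succ_prob_eq:
  assumes k: "1 \<le> k"
  shows "succ_prob p i k = s i k"
proof -
  define \<T> where "\<T> = {T. T \<subseteq> {k..} \<and> finite T \<and> card T = i}"
  define f where "f T = prob (atom T k)" for T
  have atom_event: "atom T k \<in> events" for T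
    using atom_tail sets_tail[OF k] by blast
  have "disjoint_family_on (\<lambda>T. atom T k) \<T>"
    by (auto simp: disjoint_family_on_def atom_def)
  then have nn: "(\<integral>\<^sup>+T. ennreal (f T) \<partial>count_space \<T>) = ennreal (s i k)"
    unfolding exactly_eq_UN_atom f_def emeasure_eq_measure[symmetric] \<T>_def
    using atom_event countable_finite_subsets by (subst emeasure_UN_countable) auto
  then have "integrable (count_space \<T>) f"
    by (intro integrableI_nn_integral_finite[of _ _ "s i k"]) (auto simp: f_def)
  then have summable: "Infinite_Set_Sum.abs_summable_on f \<T>"
    by (simp add: Infinite_Set_Sum.abs_summable_on_def)
  have "infsum f \<T> = infsetsum f \<T>"
    using infsetsum_infsum[OF summable] by simp
  also have "\<dots> = s i k"
    using nn by (subst infsetsum_conv_nn_integral) (auto simp: f_def)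
  finally have "infsum f \<T> = s i k" .
  moreover have "infsum f \<T> = (\<Sum>\<^sub>\<infinity>T\<in>\<T>. s0 k * (\<Prod>t\<in>T. odds p t))"
    unfolding f_def using prob_atom[OF k] by (intro infsum_cong) (auto simp: \<T>_def)
  ultimately show ?thesis
    by (simp add: succ_prob_def elem_sym_def \<T>_def infsum_cmult_right')
qed

lemma elem_sym_le_iff:
  assumes "1 \<le> k"
  shows "elem_sym p i k \<le> elem_sym p j k \<longleftrightarrow> s i k \<le> s j k"
  using s0_pos[OF assms] by (simp add: succ_prob_eq[OF assms, symmetric] succ_prob_def)

section \<open>Behaviour far out\<close>

lemma s_zero_eq:
  assumes "1 \<le> k"
  shows "s 0 k = s0 k"
proof -
  have "exactly 0 k = atom {} k"
    by (auto simp: exactly_def atom_def)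
  then show ?thesis using prob_atom[of k "{}"] assms by simp
qed

text \<open>Each tail is the whole product divided by a partial product, and the whole product is
  nonzero.\<close>

lemma s_zero_tendsto: "(\<lambda>n. s 0 (Suc n)) \<longlonglongrightarrow> 1"
proof -
  have prod: "(\<lambda>n. \<Prod>i<n. 1 - p (1 + i)) \<longlonglongrightarrow> s0 1"
    using convergent_prod_has_prod[OF convergent_prod_failures[of 1]]
    by (intro has_prod_imp_tendsto') simp
  have nz: "1 - p (1 + i) \<noteq> 0" for i
    using p_range[of "1 + i"] by auto
  have "s0 (Suc n) = s0 1 / (\<Prod>i<n. 1 - p (1 + i))" for n
    using prodinf_split_initial_segment[of "\<lambda>j. 1 - p (1 + j)" n] convergent_prod_failures[of 1] nz
    by (simp add: field_simps)
  moreover have "(\<lambda>n. s0 1 / (\<Prod>i<n. 1 - p (1 + i))) \<longlonglongrightarrow> s0 1 / s0 1"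
    using prod s0_pos[of 1] by (intro tendsto_intros) auto
  ultimately show ?thesis
    using s0_pos[of 1] by (simp add: s_zero_eq)
qed

lemma s_Suc_le:
  assumes "1 \<le> k"
  shows "s (Suc i) k \<le> 1 - s 0 k"
proof -
  have "s (Suc i) k + s 0 k = prob (exactly (Suc i) k \<union> exactly 0 k)"
    using assms by (intro finite_measure_Union[symmetric] exactly_event) (auto simp: exactly_def)
  also have "\<dots> \<le> 1" by simp
  finally show ?thesis by simp
qed

section \<open>Recursion in the starting index\<close>

lemma prob_head_tail:
  assumes "1 \<le> k" "B \<in> sets (tail_sigma (Suc k))"
  shows "prob ({\<omega> \<in> space M. X k \<omega>} \<inter> B) = p k * prob B"
    and "prob ({\<omega> \<in> space M. \<not> X k \<omega>} \<inter> B) = (1 - p k) * prob B"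
proof -
  have [measurable]: "Measurable.pred (trial_filtration M X (enat k)) (X k)"
    using assms by (intro pred_X_filtration) auto
  have "{\<omega> \<in> space (trial_filtration M X (enat k)). X k \<omega>} \<in> sets (trial_filtration M X (enat k))"
    by measurable
  from prob_past_future[OF this assms(2)]
  show "prob ({\<omega> \<in> space M. X k \<omega>} \<inter> B) = p k * prob B"
    unfolding space_trial_filtration prob_success[OF assms(1)] .
  have "{\<omega> \<in> space (trial_filtration M X (enat k)). \<not> X k \<omega>} \<in> sets (trial_filtration M X (enat k))"
    by measurable
  from prob_past_future[OF this assms(2)]
  show "prob ({\<omega> \<in> space M. \<not> X k \<omega>} \<inter> B) = (1 - p k) * prob B"
    unfolding space_trial_filtration prob_failure[OF assms(1)] .
qed

lemma s_rec:
  assumes "1 \<le> k"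
  shows "s 0 k = (1 - p k) * s 0 (Suc k)"
    and "s (Suc i) k = (1 - p k) * s (Suc i) (Suc k) + p k * s i (Suc k)"
proof -
  have "exactly 0 k = {\<omega> \<in> space M. \<not> X k \<omega>} \<inter> exactly 0 (Suc k)"
    by (auto simp: exactly_def successes_Suc[of X k])
  then show "s 0 k = (1 - p k) * s 0 (Suc k)"
    by (simp add: prob_head_tail[OF assms exactly_tail])
  have [measurable]: "Measurable.pred M (X k)" using pred_X[OF assms] .
  have "exactly (Suc i) k = ({\<omega> \<in> space M. \<not> X k \<omega>} \<inter> exactly (Suc i) (Suc k)) \<union>
      ({\<omega> \<in> space M. X k \<omega>} \<inter> exactly i (Suc k))"
    by (auto simp: exactly_def successes_Suc[of X k] notin_successes_Suc)
  also have "prob \<dots> = prob ({\<omega> \<in> space M. \<not> X k \<omega>} \<inter> exactly (Suc i) (Suc k)) +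
      prob ({\<omega> \<in> space M. X k \<omega>} \<inter> exactly i (Suc k))"
    by (intro finite_measure_Union sets.Int exactly_event) auto
  finally show "s (Suc i) k = (1 - p k) * s (Suc i) (Suc k) + p k * s i (Suc k)"
    by (simp add: prob_head_tail[OF assms exactly_tail])
qed

subsection \<open>Log-concavity and the threshold\<close>

text \<open>Shifting the index by one lets the value \<open>0\<close> stand for the non-existent
  \<open>s (- 1)\<close>, so that a single recursion covers all indices.\<close>

definition w :: "nat \<Rightarrow> nat \<Rightarrow> real" where
  "w i k = (case i of 0 \<Rightarrow> 0 | Suc j \<Rightarrow> s j k)"

lemma w_simps [simp]: "w 0 k = 0" "w (Suc i) k = s i k"
  by (simp_all add: w_def)

lemma w_nonneg: "0 \<le> w i k"
  by (cases i) simp_all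

lemma w_le_1: "w i k \<le> 1"
  by (cases i) simp_all

lemma w_rec: "1 \<le> k \<Longrightarrow> w (Suc i) k = (1 - p k) * w (Suc i) (Suc k) + p k * w i (Suc k)"
  by (cases i) (simp_all add: s_rec[of k])

text \<open>Both sides are expanded by \<open>w_rec\<close> and compared using four instances of
  \<open>next_step\<close>. All pairs \<open>i \<le> j\<close> are needed, not only neighbours,
  because the pair \<open>(i - 1, j)\<close> with a larger gap occurs among them.\<close>

lemma w_log_concave_step:
  assumes k: "1 \<le> k" and \<epsilon>: "0 \<le> \<epsilon>"
    and next_step: "\<And>i j. i \<le> j \<Longrightarrow>
      w i (Suc k) * w (Suc j) (Suc k) \<le> w (Suc i) (Suc k) * w j (Suc k) + \<epsilon>"
    and ij: "i \<le> j"
  shows "w i k * w (Suc j) k \<le> w (Suc i) k * w j k + \<epsilon>"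
proof (cases i)
  case 0
  then show ?thesis using \<epsilon> w_nonneg by simp
next
  case (Suc i')
  then obtain j' where j: "j = Suc j'" and "i' \<le> j'"
    using ij by (cases j) auto
  show ?thesis
  \<comment> \<open>For \<open>i = j\<close> the two products coincide; otherwise
    \<open>i \<le> j'\<close>, so that \<open>next_step\<close> also covers the pair
    \<open>(i, j')\<close>.\<close>
  proof (cases "i = j")
    case True
    then show ?thesis using \<epsilon> by simp
  next
    case False
    define b where "b = (\<lambda>i. w i (Suc k))"
    define q where "q = 1 - p k"
    define P where "P = p k"
    have pos: "0 \<le> q * q" "0 \<le> P * P" "0 \<le> P * q" and qP: "q + P = 1"
      using p_range[OF k] by (auto simp: q_def P_def)
    have "i \<le> j'" using False ij j by simp
    have "q * q * (b i * b (Suc j)) \<le> q * q * (b (Suc i) * b j + \<epsilon>)"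
      using next_step[OF ij] pos by (intro mult_left_mono) (simp_all add: b_def)
    moreover have "P * P * (b i' * b (Suc j')) \<le> P * P * (b (Suc i') * b j' + \<epsilon>)"
      using next_step[OF \<open>i' \<le> j'\<close>] pos unfolding b_def by (intro mult_left_mono) simp_all
    moreover have "P * q * (b i * b (Suc j')) \<le> P * q * (b (Suc i) * b j' + \<epsilon>)"
      using next_step[OF \<open>i \<le> j'\<close>] pos unfolding b_def by (intro mult_left_mono) simp_all
    moreover have "P * q * (b i' * b (Suc j)) \<le> P * q * (b (Suc i') * b j + \<epsilon>)"
      using next_step[of i' j] \<open>i' \<le> j'\<close> j pos unfolding b_def by (intro mult_left_mono) simp_all
    \<comment> \<open>The mixed terms in \<open>b i * b j\<close> cancel, and the weights of the
      four instances add up to \<open>(q + P) * (q + P) = 1\<close>, so the defect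
      \<open>\<epsilon>\<close> is not amplified.\<close>
    ultimately have "(q * b i + P * b i') * (q * b (Suc j) + P * b j)
        \<le> (q * b (Suc i) + P * b i) * (q * b j + P * b j') + (q + P) * (q + P) * \<epsilon>"
      unfolding Suc j by (simp add: algebra_simps)
    then show ?thesis
      unfolding qP using w_rec[OF k] Suc j by (simp add: b_def q_def P_def del: w_simps(2))
  qed
qed

text \<open>The numbers of successes are nearly log-concave far out, where a second success is unlikely,
  and the recursion carries the defect back unchanged.\<close>

lemma w_log_concave:
  assumes k: "1 \<le> k" and ij: "i \<le> j"
  shows "w i k * w (Suc j) k \<le> w (Suc i) k * w j k"
proof -
  have bound: "w i k * w (Suc j) k \<le> w (Suc i) k * w j k + (1 - s 0 N)"
    if "k \<le> N" "1 \<le> k" "i \<le> j" for i j k N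
    using that
  proof (induction k arbitrary: i j rule: inc_induct)
    case base
    show ?case
    proof (cases i)
      case 0
      then show ?thesis using w_nonneg by simp
    next
      case (Suc i')
      then obtain j' where j: "j = Suc j'"
        using base by (cases j) auto
      \<comment> \<open>Since \<open>j \<ge> 1\<close>, the second factor is the probability of a
        positive number of successes from \<open>N\<close> on.\<close>
      have "w i N * w (Suc j) N \<le> 1 * (1 - s 0 N)"
        using s_Suc_le[of N j'] w_nonneg w_le_1 j base by (intro mult_mono) auto
      also have "\<dots> \<le> w (Suc i) N * w j N + (1 - s 0 N)"
        using w_nonneg[of "Suc i" N] w_nonneg[of j N] by (simp del: w_simps)
      finally show ?thesis .
    qed
  next
    case (step n)
    show ?case
      by (rule w_log_concave_step) (use step in auto)
  qed
  \<comment> \<open>The defect \<open>1 - s 0 N\<close> vanishes as the starting point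
    \<open>N\<close> of the backward induction tends to infinity.\<close>
  have "(\<lambda>n. w (Suc i) k * w j k + (1 - s 0 (Suc n))) \<longlonglongrightarrow> w (Suc i) k * w j k + (1 - 1)"
    by (intro tendsto_intros s_zero_tendsto)
  moreover have "\<forall>\<^sub>F n in sequentially.
      w i k * w (Suc j) k \<le> w (Suc i) k * w j k + (1 - s 0 (Suc n))"
    using eventually_ge_at_top[of k] by eventually_elim (use bound k ij in auto)
  ultimately have "w i k * w (Suc j) k \<le> w (Suc i) k * w j k + (1 - 1)"
    by (rule tendsto_lowerbound) simp
  then show ?thesis by simp
qed

text \<open>By contraposition: if \<open>w\<close> strictly increases from \<open>Suc m\<close> to
  \<open>Suc (Suc m)\<close> at \<open>Suc k\<close>, log-concavity gives
  \<open>w m \<le> w (Suc m)\<close> there as well. Row \<open>k\<close> averages neighbouring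
  entries of row \<open>Suc k\<close>, and \<open>1 - p k > 0\<close> keeps the inequality
  strict.\<close>

lemma s_Suc_le_s_mono:
  assumes k: "1 \<le> k" and le: "s (Suc m) k \<le> s m k"
  shows "s (Suc m) (Suc k) \<le> s m (Suc k)"
proof (rule ccontr)
  assume "\<not> s (Suc m) (Suc k) \<le> s m (Suc k)"
  then have gt: "w (Suc m) (Suc k) < w (Suc (Suc m)) (Suc k)" by simp
  have lc: "w m (Suc k) * w (Suc (Suc m)) (Suc k) \<le> w (Suc m) (Suc k) * w (Suc m) (Suc k)"
    by (rule w_log_concave) auto
  have "w m (Suc k) \<le> w (Suc m) (Suc k)"
  proof (rule ccontr)
    assume "\<not> ?thesis"
    then have "w (Suc m) (Suc k) * w (Suc m) (Suc k) < w m (Suc k) * w (Suc (Suc m)) (Suc k)"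
      using gt w_nonneg by (intro mult_strict_mono') auto
    then show False using lc by simp
  qed
  then have "p k * w m (Suc k) \<le> p k * w (Suc m) (Suc k)"
    using p_range[OF k] by (intro mult_left_mono) auto
  moreover have "(1 - p k) * w (Suc m) (Suc k) < (1 - p k) * w (Suc (Suc m)) (Suc k)"
    using gt p_range[OF k] by (intro mult_strict_left_mono) auto
  ultimately have "w (Suc m) k < w (Suc (Suc m)) k"
    unfolding w_rec[OF k] by linarith
  then show False using le by simp
qed

lemma threshold_set_iff:
  "j \<in> threshold_set p (Suc m) \<longleftrightarrow> 1 \<le> j \<and> s (Suc m) (Suc j) \<le> s m (Suc j)"
  by (simp add: threshold_set_def elem_sym_le_iff)

text \<open>Far out \<open>s 0\<close> exceeds 1/2 and hence \<open>s 1\<close>; log-concavity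
  carries this comparison over to the indices \<open>m\<close> and \<open>Suc m\<close>.\<close>

lemma threshold_set_nonempty: "threshold_set p (Suc m) \<noteq> {}"
proof -
  have "\<forall>\<^sub>F n in sequentially. s 0 (Suc n) > 1 / 2"
    using s_zero_tendsto by (rule order_tendstoD) simp
  then obtain n where n: "n \<ge> 1" "s 0 (Suc n) > 1 / 2"
    using eventually_conj[OF eventually_ge_at_top[of 1]] eventually_happens'[of sequentially]
    by (metis (no_types, lifting) sequentially_bot)
  \<comment> \<open>Indices 1 and \<open>Suc m\<close> of \<open>w\<close> are indices 0 and
    \<open>m\<close> of \<open>s\<close>.\<close>
  have "s 0 (Suc n) * s (Suc m) (Suc n) \<le> s 1 (Suc n) * s m (Suc n)"
    using w_log_concave[of "Suc n" 1 "Suc m"] by simp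
  also have "\<dots> \<le> s 0 (Suc n) * s m (Suc n)"
    using s_Suc_le[of "Suc n" 0] n by (intro mult_right_mono) auto
  finally have "s (Suc m) (Suc n) \<le> s m (Suc n)"
    using n by simp
  then show ?thesis using n threshold_set_iff by blast
qed

lemma threshold_in: "threshold p (Suc m) \<in> threshold_set p (Suc m)"
  unfolding threshold_def using threshold_set_nonempty by (metis LeastI ex_in_conv)

lemma threshold_ge_1: "1 \<le> threshold p (Suc m)"
  using threshold_in threshold_set_iff by blast

text \<open>By \<open>s_Suc_le_s_mono\<close> the threshold set is upward closed, so its least
  element decides membership.\<close>

lemma threshold_le_iff:
  assumes "1 \<le> j"
  shows "threshold p (Suc m) \<le> j \<longleftrightarrow> s (Suc m) (Suc j) \<le> s m (Suc j)"
proof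
  assume "threshold p (Suc m) \<le> j"
  then show "s (Suc m) (Suc j) \<le> s m (Suc j)"
  proof (induction j rule: dec_induct)
    case base
    then show ?case using threshold_in threshold_set_iff by blast
  next
    case (step n)
    have "1 \<le> Suc n" by simp
    then show ?case using step.IH by (rule s_Suc_le_s_mono)
  qed
next
  assume "s (Suc m) (Suc j) \<le> s m (Suc j)"
  then show "threshold p (Suc m) \<le> j"
    unfolding threshold_def using assms by (intro Least_le) (simp add: threshold_set_iff)
qed

subsection \<open>Optimality\<close>

text \<open>For \<open>m \<ge> 1\<close> this is the winning probability of waiting for the first
  success from \<open>max k (threshold p m)\<close> on: the candidate for the optimal value when no
  stop has occurred before trial \<open>k\<close>.\<close>

definition value_from :: "nat \<Rightarrow> nat \<Rightarrow> real" where
  "value_from m k = s m (max k (threshold p m))"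

text \<open>The threshold determines the sign of the last factor: \<open>s (Suc m)\<close> does not
  decrease up to the threshold and does not increase from there on.\<close>

lemma s_diff_Suc:
  assumes "1 \<le> k"
  shows "s (Suc m) k - s (Suc m) (Suc k) = p k * (s m (Suc k) - s (Suc m) (Suc k))"
  by (simp add: s_rec(2)[OF assms, of m] algebra_simps)

lemma s_mono_below_threshold:
  assumes "1 \<le> k" "k \<le> threshold p (Suc m)"
  shows "s (Suc m) k \<le> s (Suc m) (threshold p (Suc m))"
  using assms(2,1)
proof (induction k rule: inc_induct)
  case (step n)
  then have "p n * (s m (Suc n) - s (Suc m) (Suc n)) \<le> 0"
    using p_range[of n] threshold_le_iff[of n m] by (intro mult_nonneg_nonpos) auto
  then show ?case
    using s_diff_Suc[of n m] step by simp
qed simp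

text \<open>The two bounds correspond to ignoring trial \<open>k\<close> and to stopping there
  whenever it is a success. From the threshold on, the second is the recursion for
  \<open>s (Suc m)\<close>; before it, stopping yields at most \<open>s (Suc m) (Suc k)\<close>,
  hence at most the value at the threshold.\<close>

lemma value_from_supersolution:
  assumes k: "1 \<le> k"
  shows "value_from (Suc m) (Suc k) \<le> value_from (Suc m) k"
    and "(1 - p k) * value_from (Suc m) (Suc k) + p k * s m (Suc k) \<le> value_from (Suc m) k"
proof -
  let ?t = "threshold p (Suc m)"
  have "value_from (Suc m) (Suc k) \<le> value_from (Suc m) k \<and>
    (1 - p k) * value_from (Suc m) (Suc k) + p k * s m (Suc k) \<le> value_from (Suc m) k"
  proof (cases "?t \<le> k")
    case True
    then have V: "value_from (Suc m) k = s (Suc m) k"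
        "value_from (Suc m) (Suc k) = s (Suc m) (Suc k)"
      by (auto simp: value_from_def max_def)
    have "0 \<le> p k * (s m (Suc k) - s (Suc m) (Suc k))"
      using True p_range[OF k] threshold_le_iff[OF k, of m] by simp
    then have "s (Suc m) (Suc k) \<le> s (Suc m) k"
      using s_diff_Suc[OF k, of m] by simp
    then show ?thesis
      unfolding V using s_rec(2)[OF k, of m] by simp
  next
    case False
    then have V: "value_from (Suc m) k = s (Suc m) ?t" "value_from (Suc m) (Suc k) = s (Suc m) ?t"
      by (auto simp: value_from_def max_def)
    have "s m (Suc k) \<le> s (Suc m) (Suc k)"
      using False threshold_le_iff[OF k, of m] by simp
    also have "\<dots> \<le> s (Suc m) ?t"
      using False by (intro s_mono_below_threshold) auto
    finally have "p k * s m (Suc k) \<le> p k * s (Suc m) ?t"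
      using p_range[OF k] by (intro mult_left_mono) auto
    then show ?thesis
      unfolding V by (simp add: algebra_simps)
  qed
  then show "value_from (Suc m) (Suc k) \<le> value_from (Suc m) k"
    "(1 - p k) * value_from (Suc m) (Suc k) + p k * s m (Suc k) \<le> value_from (Suc m) k"
    by auto
qed

text \<open>The probability of having won by a stop within the first \<open>N\<close> trials, plus
  the candidate value weighted by the probability of no stop so far, does not increase with
  \<open>N\<close>. It starts at no more than \<open>value_from (Suc m) 1\<close>.\<close>

lemma win_prob_le_value:
  assumes \<sigma>: "stopping_rule M X \<sigma>"
  shows "win_prob M X (Suc m) \<sigma> \<le> value_from (Suc m) 1"
proof -
  let ?F = "\<lambda>n. trial_filtration M X (enat n)"
  let ?V = "value_from (Suc m)"
  \<comment> \<open>The shift by one is harmless because a stopping rule never stops at time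
    0.\<close>
  define S where "S n = {\<omega> \<in> space M. \<sigma> \<omega> = enat (Suc n)}" for n
  define A where "A n = {\<omega> \<in> space M. enat n < \<sigma> \<omega>}" for n
  have st: "stopping_time (trial_filtration M X) \<sigma>"
    and succ: "\<And>\<omega> n. \<omega> \<in> space M \<Longrightarrow> \<sigma> \<omega> = enat n \<Longrightarrow> 1 \<le> n \<and> X n \<omega>"
    using \<sigma> unfolding stopping_rule_def by auto
  have A_F: "A n \<in> sets (?F n)" for n
    using predE[OF stopping_timeD2[OF st, of "enat n"]] by (simp add: A_def)
  have filtration_mono: "sets (?F n) \<subseteq> sets (?F (Suc n))" for n
  proof -
    have "{X j -` A \<inter> space M | j A. 1 \<le> j \<and> enat j \<le> enat n}
        \<subseteq> {X j -` A \<inter> space M | j A. 1 \<le> j \<and> enat j \<le> enat (Suc n)}" (is "?E \<subseteq> ?E'")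
    proof -
      have "enat j \<le> enat (Suc n)" if "enat j \<le> enat n" for j
        using that by simp
      then show ?thesis by blast
    qed
    then have "sigma_sets (space M) ?E \<subseteq> sigma_sets (space M) ?E'"
      by (rule sigma_sets_mono')
    moreover have "sets (?F n) = sigma_sets (space M) ?E" "sets (?F (Suc n)) = sigma_sets (space M) ?E'"
      unfolding trial_filtration_def by (rule sets_measure_of; auto)+
    ultimately show ?thesis by (simp only:)
  qed
  have S_F: "S n \<in> sets (?F (Suc n))" for n
  proof -
    have "{\<omega> \<in> space M. \<sigma> \<omega> \<le> enat (Suc n)} \<in> sets (?F (Suc n))"
      using predE[OF stopping_timeD[OF st, of "enat (Suc n)"]] by simp
    moreover have "S n = A n \<inter> {\<omega> \<in> space M. \<sigma> \<omega> \<le> enat (Suc n)}"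
    proof -
      have "\<sigma> \<omega> = enat (Suc n) \<longleftrightarrow> enat n < \<sigma> \<omega> \<and> \<sigma> \<omega> \<le> enat (Suc n)" for \<omega>
        by (cases "\<sigma> \<omega>") auto
      then show ?thesis by (auto simp: S_def A_def)
    qed
    ultimately show ?thesis
      using A_F filtration_mono by (metis sets.Int subsetD)
  qed
  have A_event: "A n \<in> events" and S_event: "S n \<in> events" for n
    using A_F S_F sets_filtration by blast+
  \<comment> \<open>\<open>A n\<close> is decided by the first \<open>n\<close> trials, hence
    independent of trial \<open>n + 1\<close>, and a stop there needs a success.\<close>
  have prob_S_le: "prob (S n) \<le> prob (A n) * p (Suc n)" for n
  proof -
    have X_tail: "{\<omega> \<in> space M. X (Suc n) \<omega>} \<in> sets (tail_sigma (Suc n))"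
      using predE[OF pred_X_tail[of "Suc n" "Suc n"]] by simp
    have "prob (S n) \<le> prob (A n \<inter> {\<omega> \<in> space M. X (Suc n) \<omega>})"
      using succ A_event predE[OF pred_X[of "Suc n"]]
      by (intro finite_measure_mono) (auto simp: S_def A_def)
    also have "\<dots> = prob (A n) * p (Suc n)"
      unfolding prob_past_future[OF A_F X_tail] by (simp add: prob_success)
    finally show ?thesis .
  qed
  have prob_A_Suc: "prob (A (Suc n)) = prob (A n) - prob (S n)" for n
  proof -
    have "enat n < \<sigma> \<omega> \<longleftrightarrow> enat (Suc n) < \<sigma> \<omega> \<or> \<sigma> \<omega> = enat (Suc n)" for \<omega>
      by (cases "\<sigma> \<omega>") auto
    then have "A n = A (Suc n) \<union> S n" "A (Suc n) \<inter> S n = {}"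
      by (auto simp: A_def S_def)
    then show ?thesis
      using finite_measure_Union[OF A_event S_event] by (metis add_diff_cancel_right')
  qed
  have partial: "(\<Sum>n<N. prob (S n) * s m (Suc (Suc n))) + prob (A N) * ?V (Suc N) \<le> ?V 1" for N
  proof (induction N)
    case 0
    show ?case
      using mult_right_mono[of "prob (A 0)" 1 "?V 1"] by (simp add: value_from_def)
  next
    case (Suc N)
    let ?V' = "?V (Suc (Suc N))" and ?s = "s m (Suc (Suc N))"
    have "prob (S N) * ?s + prob (A (Suc N)) * ?V' \<le> prob (A N) * ?V (Suc N)"
    \<comment> \<open>Given \<open>prob (A N)\<close>, the left side is affine in
      \<open>prob (S N)\<close>, which ranges between 0 and \<open>prob (A N) * p (Suc N)\<close>.
      The sign of \<open>?s - ?V'\<close> tells which end is worst, and each end is covered by one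
      of the two supersolution inequalities.\<close>
    proof (cases "?s \<le> ?V'")
      case True
      have "prob (S N) * ?s \<le> prob (S N) * ?V'"
        using True by (intro mult_left_mono) auto
      then have "prob (S N) * ?s + prob (A (Suc N)) * ?V' \<le> prob (A N) * ?V'"
        unfolding prob_A_Suc by (simp add: algebra_simps)
      also have "\<dots> \<le> prob (A N) * ?V (Suc N)"
        using value_from_supersolution(1)[of "Suc N" m] by (intro mult_left_mono) auto
      finally show ?thesis .
    next
      case False
      have "prob (S N) * (?s - ?V') \<le> prob (A N) * p (Suc N) * (?s - ?V')"
        using False prob_S_le by (intro mult_right_mono) auto
      then have "prob (S N) * ?s + prob (A (Suc N)) * ?V'
          \<le> prob (A N) * ((1 - p (Suc N)) * ?V' + p (Suc N) * ?s)"
        unfolding prob_A_Suc by (simp add: algebra_simps)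
      also have "\<dots> \<le> prob (A N) * ?V (Suc N)"
        using value_from_supersolution(2)[of "Suc N" m] by (intro mult_left_mono) auto
      finally show ?thesis .
    qed
    then show ?case using Suc by simp
  qed
  \<comment> \<open>The success stopped at counts itself, so \<open>m\<close> later ones make it the
    \<open>Suc m\<close>-th last.\<close>
  define W where "W n = S n \<inter> exactly m (Suc (Suc n))" for n
  have prob_W: "prob (W n) = prob (S n) * s m (Suc (Suc n))" for n
    unfolding W_def by (rule prob_past_future[OF S_F exactly_tail])
  have "(\<exists>n. \<sigma> \<omega> = enat n \<and> (\<lambda>j. of_bool (X (n + j) \<omega>) :: nat) sums Suc m) \<longleftrightarrow>
      (\<exists>n. \<omega> \<in> W n)" if \<omega>: "\<omega> \<in> space M" for \<omega>
  proof -
    have "\<omega> \<in> W n \<longleftrightarrow> \<sigma> \<omega> = enat (Suc n) \<and>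
        (\<lambda>j. of_bool (X (Suc n + j) \<omega>) :: nat) sums Suc m" for n
      using succ[OF \<omega>, of "Suc n"] \<omega> unfolding sums_successes_iff W_def S_def exactly_def
      by (auto simp: successes_Suc[of X "Suc n"] notin_successes_Suc)
    moreover have "\<sigma> \<omega> \<noteq> enat 0"
      using succ[OF \<omega>, of 0] by auto
    ultimately show ?thesis
      by (metis not0_implies_Suc)
  qed
  then have "win_prob M X (Suc m) \<sigma> = prob (\<Union>n. W n)"
    unfolding win_prob_def by (intro arg_cong[where f=prob]) (auto simp: W_def S_def)
  moreover have "(\<lambda>n. prob (W n)) sums prob (\<Union>n. W n)"
    using S_event exactly_event
    by (intro finite_measure_UNION) (auto simp: W_def S_def disjoint_family_on_def)
  moreover have "(\<Sum>n<N. prob (W n)) \<le> ?V 1" for N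
  proof -
    have "0 \<le> prob (A N) * ?V (Suc N)" by (simp add: value_from_def)
    then show ?thesis using partial[of N] unfolding prob_W by linarith
  qed
  ultimately show ?thesis
    unfolding sums_def by (metis LIMSEQ_le_const2)
qed

section \<open>Attainment of the bound\<close>

lemma stopping_rule_first_success_from:
  assumes k: "1 \<le> k"
  shows "stopping_rule M X (first_success_from X k)"
proof -
  have "Measurable.pred (trial_filtration M X t) (\<lambda>\<omega>. first_success_from X k \<omega> \<le> t)" for t
  proof (cases t)
    case (enat n)
    have "first_success_from X k \<omega> \<le> enat n \<longleftrightarrow> (\<exists>j\<in>{k..n}. X j \<omega>)" for \<omega>
    proof
      assume le: "first_success_from X k \<omega> \<le> enat n"
      then obtain l where l: "first_success_from X k \<omega> = enat l"
        by (cases "first_success_from X k \<omega>") auto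
      then show "\<exists>j\<in>{k..n}. X j \<omega>"
        using le first_success_from_eq_enat_iff[of X k \<omega> l] by auto
    next
      assume "\<exists>j\<in>{k..n}. X j \<omega>"
      then obtain j where "k \<le> j" "j \<le> n" "X j \<omega>" by auto
      then show "first_success_from X k \<omega> \<le> enat n"
        using first_success_from_le order_trans by (metis enat_ord_simps(1))
    qed
    moreover have "Measurable.pred (trial_filtration M X (enat n)) (\<lambda>\<omega>. \<exists>j\<in>{k..n}. X j \<omega>)"
      using k by (intro pred_intros_finite pred_X_filtration) auto
    ultimately show ?thesis
      unfolding enat by simp
  qed simp
  then show ?thesis
    using k unfolding stopping_rule_def stopping_time_def
    by (auto simp: first_success_from_eq_enat_iff)
qed

text \<open>No success lies between \<open>k\<close> and the stop, so both count the same successes.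
  The condition \<open>1 \<le> m\<close> discards outcomes without any success, where the rule never
  stops.\<close>

lemma win_prob_first_success_from:
  assumes m: "1 \<le> m"
  shows "win_prob M X m (first_success_from X k) = s m k"
proof -
  have "(\<exists>n. first_success_from X k \<omega> = enat n \<and> (\<lambda>j. of_bool (X (n + j) \<omega>) :: nat) sums m) \<longleftrightarrow>
      finite (successes X k \<omega>) \<and> card (successes X k \<omega>) = m" for \<omega>
  proof -
    have eq: "successes X n \<omega> = successes X k \<omega>" if "first_success_from X k \<omega> = enat n" for n
      using that unfolding first_success_from_eq_enat_iff successes_def
      by (auto simp: not_less[symmetric])
    have "\<exists>n. first_success_from X k \<omega> = enat n" if nonempty: "successes X k \<omega> \<noteq> {}"
    proof -
      obtain j where "k \<le> j" "X j \<omega>"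
        using nonempty by (auto simp: successes_def)
      then have "first_success_from X k \<omega> \<le> enat j"
        by (rule first_success_from_le)
      then show ?thesis
        by (cases "first_success_from X k \<omega>") auto
    qed
    then show ?thesis
      unfolding sums_successes_iff using eq m by fastforce
  qed
  then show ?thesis
    unfolding win_prob_def exactly_def by simp
qed

end

theorem theorem11:
  fixes M :: "'a measure" and X :: "nat \<Rightarrow> 'a \<Rightarrow> bool" and p :: "nat \<Rightarrow> real" and m :: nat
  assumes "prob_space M"
    and "prob_space.indep_vars M (\<lambda>_. count_space UNIV) X {1..}"
    and "\<And>k. 1 \<le> k \<Longrightarrow> measure M {\<omega> \<in> space M. X k \<omega>} = p k"
    and "\<And>k. 1 \<le> k \<Longrightarrow> 0 \<le> p k \<and> p k < 1"
    and "summable (\<lambda>k. p (Suc k))"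
    and "1 \<le> m"
  shows "threshold_set p m \<noteq> {}
    \<and> (\<exists>\<tau>. optimal_rule M X m \<tau>)
    \<and> optimal_rule M X m (first_success_from X (threshold p m))
    \<and> optimal_value M X m = succ_prob p m (threshold p m)"
proof -
  interpret bernoulli_trials M X p
    using assms by (simp add: bernoulli_trials_def bernoulli_trials_axioms_def)
  obtain m' where m: "m = Suc m'"
    using assms(6) by (cases m) auto
  let ?t = "threshold p m"
  have t: "1 \<le> ?t" unfolding m by (rule threshold_ge_1)
  have rule: "stopping_rule M X (first_success_from X ?t)"
    using t by (rule stopping_rule_first_success_from)
  have win: "win_prob M X m (first_success_from X ?t) = s m ?t"
    using assms(6) by (rule win_prob_first_success_from)
  \<comment> \<open>\<open>value_from m 1\<close> is \<open>s m ?t\<close> because the threshold is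
    at least 1.\<close>
  have upper: "win_prob M X m \<sigma> \<le> s m ?t" if "stopping_rule M X \<sigma>" for \<sigma>
    using win_prob_le_value[OF that, of m'] t by (simp add: value_from_def m max_def)
  have optimal: "optimal_rule M X m (first_success_from X ?t)"
    unfolding optimal_rule_def win using rule upper by blast
  have "optimal_value M X m = s m ?t"
    unfolding optimal_value_def
  proof (rule cSup_eq_maximum)
    show "s m ?t \<in> win_prob M X m ` {\<tau>. stopping_rule M X \<tau>}"
      using rule win[symmetric] by (intro image_eqI) auto
  qed (use upper in auto)
  then show ?thesis
    using optimal threshold_set_nonempty[of m'] succ_prob_eq[OF t, of m] m by auto
qed

end
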